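(* Let $\mathcal{Z}$ be a finite set with a distinguished element $0\in\mathcal{Z}$, let $E=\prod_{z\in\mathcal{Z}}(L_z,U_z)$ be a product of $|\mathcal{Z}|$ intervals of the real line, let $c\in\mathbb{R}$, $\Lambda=\{q\in\mathbb{R}^{|\mathcal{Z}|}:\sum_{z\in\mathcal{Z}}q_z=c\}$, and let $q\in\Lambda$. Let $Q:E\to\Lambda$ be a continuous function such that: (i) $Q$ has the weak substitutes property; (ii) $Q$ has the pivotal substitutes property around $q$; (iii) for all $x\in\mathcal{Z}$, $Q$ is responsive to $x$ around $q_x$; (iv) one can order the elements of $\mathcal{Z}$ as $\mathcal{Z}=\{z_1=0,z_2,z_3,\dots,z_{|\mathcal{Z}|}\}$ so that for each $k\ge 2$ there is a function $\bar Q_{z_k}$ on $E$ with $Q_{z_k}(p)\le\bar Q_{z_k}(p)$ for all $p\in E$, where $\bar Q_{z_k}(p)$ does not depend on $p_{z_{k+1}},\dots,p_{z_{|\mathcal{Z}|}}$ and is downward responsive around $q$ (i.e. $\lim_{p_{z_k}\to L_{z_k}}\bar Q_{z_k}(p)<q_{z_k}$, the other coordinates being fixed). Then, for any $\pi\in(L_0,U_0)$, there is a $p^*\in E$ with $Q(p^* )=q$ and $p_0^*=\pi$.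
   Context: The bounds satisfy $-\infty\le L_z<U_z\le+\infty$. Definitions, for $Q:E\to\mathbb{R}^{|\mathcal{Z}|}$ and $q\in\mathbb{R}^{|\mathcal{Z}|}$: Weak substitutes: for all $x\ne y$ in $\mathcal{Z}$, $Q_x(p)$ is nondecreasing in $p_x$ and nonincreasing in $p_y$. Pivotal substitutes around $q$: $Q$ has the downward (resp. upward) pivotal substitutes property around $q$ if for every nonempty proper subset $\mathcal{X}\subset\mathcal{Z}$ and every fixed value of $(p_x)_{x\in\mathcal{X}}$, the sum $\sum_{x\in\mathcal{X}}Q_x(p)$ becomes (i.e. eventually is) strictly smaller (resp. strictly larger) than $\sum_{x\in\mathcal{X}}q_x$ as every $p_z$, $z\notin\mathcal{X}$, tends to its upper bound $U_z$ (resp. to its lower bound $L_z$). It has the pivotal substitutes property around $q$ if it has both. Responsiveness: $Q$ is upward responsive (resp. downward responsive) to $x$ around $q_x$ if, the other coordinates of $p$ being fixed arbitrarily, $\lim_{p_x\to U_x}Q_x(p)>q_x$ (resp. $\lim_{p_x\to L_x}Q_x(p)<q_x$). It is responsive to $x$ around $q_x$ if it is both upward and downward responsive. *)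

theory Defs
  imports "HOL-Analysis.Analysis"
begin

text \<open>
  The finite index set is the universe of a type \<open>'z::finite\<close>, so price and quantity
  vectors are elements of \<open>real ^ 'z\<close>. The interval bounds may be infinite, hence
  \<open>L, U :: 'z \<Rightarrow> ereal\<close>.
\<close>

definition open_box :: "('z::finite \<Rightarrow> ereal) \<Rightarrow> ('z \<Rightarrow> ereal) \<Rightarrow> (real ^ 'z) set" where
  "open_box L U = {p. \<forall>z. L z < ereal (p $ z) \<and> ereal (p $ z) < U z}"

definition quantity_plane :: "real \<Rightarrow> (real ^ 'z::finite) set" where
  "quantity_plane c = {q. (\<Sum>z\<in>UNIV. q $ z) = c}"

text \<open>
  The filter on the box describing that all coordinates \<open>p $ z\<close> with \<open>z \<in> S\<close> tend jointly,
  and independently of each other, to their upper bounds \<open>U z\<close>, while every other coordinate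
  is frozen at its value in \<open>a\<close>. Using \<open>at_left\<close> on \<open>ereal\<close> treats finite bounds and \<open>\<infinity>\<close> alike.
\<close>

definition to_upper ::
    "('z::finite \<Rightarrow> ereal) \<Rightarrow> ('z \<Rightarrow> ereal) \<Rightarrow> 'z set \<Rightarrow> real ^ 'z \<Rightarrow> (real ^ 'z) filter" where
  "to_upper L U S a =
     inf (INF z\<in>S. filtercomap (\<lambda>p. ereal (p $ z)) (at_left (U z)))
         (principal {p \<in> open_box L U. \<forall>x. x \<notin> S \<longrightarrow> p $ x = a $ x})"

definition to_lower ::
    "('z::finite \<Rightarrow> ereal) \<Rightarrow> ('z \<Rightarrow> ereal) \<Rightarrow> 'z set \<Rightarrow> real ^ 'z \<Rightarrow> (real ^ 'z) filter" where
  "to_lower L U S a =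
     inf (INF z\<in>S. filtercomap (\<lambda>p. ereal (p $ z)) (at_right (L z)))
         (principal {p \<in> open_box L U. \<forall>x. x \<notin> S \<longrightarrow> p $ x = a $ x})"

definition weak_substitutes ::
    "('z::finite \<Rightarrow> ereal) \<Rightarrow> ('z \<Rightarrow> ereal) \<Rightarrow> (real ^ 'z \<Rightarrow> real ^ 'z) \<Rightarrow> bool" where
  "weak_substitutes L U Q \<longleftrightarrow>
     (\<forall>x y. x \<noteq> y \<longrightarrow>
        (\<forall>p\<in>open_box L U. \<forall>p'\<in>open_box L U.
           (\<forall>z. z \<noteq> x \<longrightarrow> p $ z = p' $ z) \<and> p $ x \<le> p' $ x \<longrightarrow> Q p $ x \<le> Q p' $ x) \<and>
        (\<forall>p\<in>open_box L U. \<forall>p'\<in>open_box L U.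
           (\<forall>z. z \<noteq> y \<longrightarrow> p $ z = p' $ z) \<and> p $ y \<le> p' $ y \<longrightarrow> Q p' $ x \<le> Q p $ x))"

definition downward_pivotal_substitutes ::
    "('z::finite \<Rightarrow> ereal) \<Rightarrow> ('z \<Rightarrow> ereal) \<Rightarrow> (real ^ 'z \<Rightarrow> real ^ 'z) \<Rightarrow> real ^ 'z \<Rightarrow> bool" where
  "downward_pivotal_substitutes L U Q q \<longleftrightarrow>
     (\<forall>X. X \<noteq> {} \<and> X \<subset> UNIV \<longrightarrow> (\<forall>a\<in>open_box L U.
        \<forall>\<^sub>F p in to_upper L U (- X) a. (\<Sum>x\<in>X. Q p $ x) < (\<Sum>x\<in>X. q $ x)))"

definition upward_pivotal_substitutes ::
    "('z::finite \<Rightarrow> ereal) \<Rightarrow> ('z \<Rightarrow> ereal) \<Rightarrow> (real ^ 'z \<Rightarrow> real ^ 'z) \<Rightarrow> real ^ 'z \<Rightarrow> bool" where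
  "upward_pivotal_substitutes L U Q q \<longleftrightarrow>
     (\<forall>X. X \<noteq> {} \<and> X \<subset> UNIV \<longrightarrow> (\<forall>a\<in>open_box L U.
        \<forall>\<^sub>F p in to_lower L U (- X) a. (\<Sum>x\<in>X. Q p $ x) > (\<Sum>x\<in>X. q $ x)))"

definition pivotal_substitutes ::
    "('z::finite \<Rightarrow> ereal) \<Rightarrow> ('z \<Rightarrow> ereal) \<Rightarrow> (real ^ 'z \<Rightarrow> real ^ 'z) \<Rightarrow> real ^ 'z \<Rightarrow> bool" where
  "pivotal_substitutes L U Q q \<longleftrightarrow>
     downward_pivotal_substitutes L U Q q \<and> upward_pivotal_substitutes L U Q q"

text \<open>
  Responsiveness is stated for a scalar function \<open>f\<close> (a component of \<open>Q\<close> or a bound for one);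
  \<open>r\<close> is the reference level. The limit is taken in \<open>ereal\<close>, since it may well be infinite.
\<close>

definition upward_responsive ::
    "('z::finite \<Rightarrow> ereal) \<Rightarrow> ('z \<Rightarrow> ereal) \<Rightarrow> (real ^ 'z \<Rightarrow> real) \<Rightarrow> 'z \<Rightarrow> real \<Rightarrow> bool" where
  "upward_responsive L U f x r \<longleftrightarrow>
     (\<forall>a\<in>open_box L U. \<exists>l. ((\<lambda>p. ereal (f p)) \<longlongrightarrow> l) (to_upper L U {x} a) \<and> l > ereal r)"

definition downward_responsive ::
    "('z::finite \<Rightarrow> ereal) \<Rightarrow> ('z \<Rightarrow> ereal) \<Rightarrow> (real ^ 'z \<Rightarrow> real) \<Rightarrow> 'z \<Rightarrow> real \<Rightarrow> bool" where
  "downward_responsive L U f x r \<longleftrightarrow>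
     (\<forall>a\<in>open_box L U. \<exists>l. ((\<lambda>p. ereal (f p)) \<longlongrightarrow> l) (to_lower L U {x} a) \<and> l < ereal r)"

definition responsive ::
    "('z::finite \<Rightarrow> ereal) \<Rightarrow> ('z \<Rightarrow> ereal) \<Rightarrow> (real ^ 'z \<Rightarrow> real) \<Rightarrow> 'z \<Rightarrow> real \<Rightarrow> bool" where
  "responsive L U f x r \<longleftrightarrow> upward_responsive L U f x r \<and> downward_responsive L U f x r"

end

theory Submission
  imports Defs
begin

text \<open>
  Freeze \<open>p $ z0 = \<pi>\<close> and consider the set \<open>A\<close> of price vectors with \<open>Q p $ z \<le> q $ z\<close> for all
  \<open>z \<noteq> z0\<close>. Choosing the prices one after the other along the given ordering, low enough for the
  bounds on the demand, shows that \<open>A\<close> is nonempty. By weak substitutes \<open>A\<close> behaves like a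
  join-semilattice, so its coordinatewise supremum \<open>s\<close> again satisfies \<open>Q s $ z \<le> q $ z\<close>, provided
  \<open>s\<close> lies in the box. It does: if the prices of a nonempty set \<open>S\<close> of goods could approach their
  upper bounds within \<open>A\<close>, then they could do so with the other prices frozen at their suprema and
  with total demand for \<open>S\<close> at most \<open>\<Sum>z\<in>S. q $ z\<close>, contradicting downward pivotality. Finally,
  maximality of \<open>s\<close> and continuity force equality for every \<open>z \<noteq> z0\<close>, hence also for \<open>z0\<close>
  because the coordinates of \<open>Q s\<close> and \<open>q\<close> have the same sum.
\<close>

section \<open>The box and updates of a single price\<close>

definition upd :: "real ^ 'z::finite \<Rightarrow> 'z \<Rightarrow> real \<Rightarrow> real ^ 'z" where
  "upd p z t = (\<chi> i. if i = z then t else p $ i)"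

lemma upd_nth [simp]: "upd p z t $ i = (if i = z then t else p $ i)"
  by (simp add: upd_def)

lemma upd_same [simp]: "upd p z (p $ z) = p"
  by (simp add: vec_eq_iff)

lemma isCont_upd: "isCont (upd p z) t"
proof -
  have "isCont (\<lambda>t. if i = z then t else p $ i) t" for i
    by (cases "i = z") simp_all
  then show ?thesis
    unfolding upd_def isCont_def by (intro vec_tendstoI) simp
qed

lemma open_open_box: "open (open_box L U)"
proof -
  have "open {p :: real ^ 'a. L z < ereal (p $ z) \<and> ereal (p $ z) < U z}" for z
    by (intro open_Collect_conj open_Collect_less continuous_intros)
  moreover have "open_box L U = (\<Inter>z. {p. L z < ereal (p $ z) \<and> ereal (p $ z) < U z})"
    by (auto simp: open_box_def)
  ultimately show ?thesis
    by auto
qed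

lemma open_box_nonempty:
  assumes "\<And>z. L z < U z"
  obtains p where "p \<in> open_box L U"
proof -
  have "\<forall>z. \<exists>t. L z < ereal t \<and> ereal t < U z"
    using assms ereal_dense2 by blast
  then obtain f where "\<forall>z. L z < ereal (f z) \<and> ereal (f z) < U z"
    by metis
  then have "(\<chi> z. f z) \<in> open_box L U"
    by (simp add: open_box_def)
  then show thesis
    by (rule that)
qed

lemma upd_in_open_box:
  assumes "p \<in> open_box L U" "L z < ereal t" "ereal t < U z"
  shows "upd p z t \<in> open_box L U"
  using assms by (simp add: open_box_def)

section \<open>Explicit price thresholds extracted from the limit filters\<close>

lemma eventually_to_lower_singletonD:
  assumes "eventually P (to_lower L U {x} a)" "L x < U x"
  obtains M where "M > L x"
    "\<And>p. \<lbrakk>p \<in> open_box L U; \<And>z. z \<noteq> x \<Longrightarrow> p $ z = a $ z; ereal (p $ x) < M\<rbrakk> \<Longrightarrow> P p"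
proof -
  from assms(1) obtain R where R: "eventually R (at_right (L x))"
    "\<And>p. \<lbrakk>R (ereal (p $ x)); p \<in> open_box L U; \<And>z. z \<noteq> x \<Longrightarrow> p $ z = a $ z\<rbrakk> \<Longrightarrow> P p"
    unfolding to_lower_def by (auto simp: eventually_inf_principal eventually_filtercomap)
  from R(1) obtain M where "M > L x" "\<And>y. y > L x \<Longrightarrow> y < M \<Longrightarrow> R y"
    using eventually_at_right[OF assms(2)] by blast
  with R(2) show thesis
    by (intro that[of M]) (auto simp: open_box_def)
qed

text \<open>An event of a finite infimum of filters splits into one event per coordinate, and each
  \<open>at_left (U z)\<close> then yields its own cutoff. So \<open>P\<close> holds on a product
  region, with no coupling between the rates at which the prices rise.\<close>

lemma eventually_to_upperD:
  assumes "eventually P (to_upper L U S a)" "\<And>z. L z < U z"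
  obtains M where "\<And>z. z \<in> S \<Longrightarrow> M z < U z"
    "\<And>p. \<lbrakk>p \<in> open_box L U; \<And>z. z \<notin> S \<Longrightarrow> p $ z = a $ z; \<And>z. z \<in> S \<Longrightarrow> M z < ereal (p $ z)\<rbrakk> \<Longrightarrow> P p"
proof -
  from assms(1) have "\<exists>R. (\<forall>z\<in>S. eventually (R z) (filtercomap (\<lambda>p. ereal (p $ z)) (at_left (U z)))) \<and>
      (\<forall>p. (\<forall>z\<in>S. R z p) \<longrightarrow> p \<in> {p \<in> open_box L U. \<forall>x. x \<notin> S \<longrightarrow> p $ x = a $ x} \<longrightarrow> P p)"
    unfolding to_upper_def eventually_inf_principal by (subst (asm) eventually_INF_finite) simp_all
  then obtain R where
    R: "\<And>z. z \<in> S \<Longrightarrow> eventually (R z) (filtercomap (\<lambda>p. ereal (p $ z)) (at_left (U z)))"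
    and P: "\<And>p. \<lbrakk>\<And>z. z \<in> S \<Longrightarrow> R z p; p \<in> open_box L U; \<And>z. z \<notin> S \<Longrightarrow> p $ z = a $ z\<rbrakk> \<Longrightarrow> P p"
    by blast
  have "\<exists>M<U z. \<forall>p. M < ereal (p $ z) \<and> ereal (p $ z) < U z \<longrightarrow> R z p" if "z \<in> S" for z
  proof -
    from R[OF that] obtain T where T: "eventually T (at_left (U z))" "\<And>p. T (ereal (p $ z)) \<Longrightarrow> R z p"
      by (auto simp: eventually_filtercomap)
    from T(1) obtain M where "M < U z" "\<And>y. y > M \<Longrightarrow> y < U z \<Longrightarrow> T y"
      using eventually_at_left[OF assms(2)] by blast
    with T(2) show ?thesis
      by blast
  qed
  then obtain M where
    "\<And>z. z \<in> S \<Longrightarrow> M z < U z \<and> (\<forall>p. M z < ereal (p $ z) \<and> ereal (p $ z) < U z \<longrightarrow> R z p)"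
    by metis
  with P show thesis
    by (intro that[of M]) (auto simp: open_box_def)
qed

section \<open>Joint price increases, a point of \<open>A\<close>, and bounds on
  \<open>A\<close>\<close>

lemma weak_substitutes_antimono:
  assumes weak: "weak_substitutes L U Q"
    and p: "p \<in> open_box L U" and r: "r \<in> open_box L U"
    and le: "\<And>y. p $ y \<le> r $ y" and eq: "r $ x = p $ x"
  shows "Q r $ x \<le> Q p $ x"
proof -
  \<comment> \<open>\<open>weak_substitutes\<close> moves one price at a time, so \<open>m\<close>
    passes from \<open>p\<close> to \<open>r\<close> coordinate by coordinate; the box is a product,
    hence contains every intermediate vector. The move at \<open>x\<close> itself is void by
    \<open>eq\<close>.\<close>
  define m where "m T = (\<chi> y. if y \<in> T then r $ y else p $ y)" for T
  have box: "m T \<in> open_box L U" for T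
    using p r by (auto simp: m_def open_box_def)
  have "finite T \<Longrightarrow> Q (m T) $ x \<le> Q p $ x" for T
  proof (induction T rule: finite_induct)
    case empty
    then show ?case
      by (simp add: m_def)
  next
    case (insert y T)
    show ?case
    proof (cases "y = x")
      case True
      then have "m (insert y T) = m T"
        using eq by (auto simp: m_def vec_eq_iff)
      with insert.IH show ?thesis
        by simp
    next
      case False
      have "\<forall>z. z \<noteq> y \<longrightarrow> m T $ z = m (insert y T) $ z" "m T $ y \<le> m (insert y T) $ y"
        using le by (auto simp: m_def)
      then have "Q (m (insert y T)) $ x \<le> Q (m T) $ x"
        using weak box False unfolding weak_substitutes_def by metis
      with insert.IH show ?thesis
        by simp
    qed
  qed
  from this[of UNIV] show ?thesis
    by (simp add: m_def)
qed

text \<open>Lowering a later price may raise the earlier components of \<open>Q\<close>, so the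
  induction controls the bounds \<open>B k\<close> instead: they ignore all later prices and survive
  the later choices.\<close>

lemma ex_low_demand:
  fixes L U :: "'z::finite \<Rightarrow> ereal"
  assumes bounds: "\<And>z. L z < U z"
    and dist: "distinct zs" and zs0: "zs \<noteq> []" "zs ! 0 = z0"
    and Qbar: "\<And>k. \<lbrakk>1 \<le> k; k < length zs\<rbrakk> \<Longrightarrow>
        (\<exists>Qbar :: real ^ 'z \<Rightarrow> real.
          (\<forall>p\<in>open_box L U. Q p $ (zs ! k) \<le> Qbar p) \<and>
          (\<forall>p\<in>open_box L U. \<forall>p'\<in>open_box L U.
             (\<forall>i\<le>k. p $ (zs ! i) = p' $ (zs ! i)) \<longrightarrow> Qbar p = Qbar p') \<and>
          downward_responsive L U Qbar (zs ! k) (q $ (zs ! k)))"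
    and pi: "L z0 < ereal \<pi>" "ereal \<pi> < U z0"
  obtains p where "p \<in> open_box L U" "p $ z0 = \<pi>"
    "\<And>k. \<lbrakk>1 \<le> k; k < length zs\<rbrakk> \<Longrightarrow> Q p $ (zs ! k) \<le> q $ (zs ! k)"
proof -
  define ok where "ok k B \<longleftrightarrow> (\<forall>p\<in>open_box L U. Q p $ (zs ! k) \<le> B p) \<and>
      (\<forall>p\<in>open_box L U. \<forall>p'\<in>open_box L U.
         (\<forall>i\<le>k. p $ (zs ! i) = p' $ (zs ! i)) \<longrightarrow> B p = B p') \<and>
      downward_responsive L U B (zs ! k) (q $ (zs ! k))" for k and B :: "real ^ 'z \<Rightarrow> real"
  have "\<forall>k. \<exists>B. 1 \<le> k \<longrightarrow> k < length zs \<longrightarrow> ok k B"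
    using Qbar unfolding ok_def by blast
  then obtain B where ok: "\<And>k. \<lbrakk>1 \<le> k; k < length zs\<rbrakk> \<Longrightarrow> ok k (B k)"
    by (metis (lifting))
  have B: "\<And>k p. \<lbrakk>1 \<le> k; k < length zs; p \<in> open_box L U\<rbrakk> \<Longrightarrow> Q p $ (zs ! k) \<le> B k p"
      "\<And>k p p'. \<lbrakk>1 \<le> k; k < length zs; p \<in> open_box L U; p' \<in> open_box L U;
          \<And>i. i \<le> k \<Longrightarrow> p $ (zs ! i) = p' $ (zs ! i)\<rbrakk> \<Longrightarrow> B k p = B k p'"
      "\<And>k. \<lbrakk>1 \<le> k; k < length zs\<rbrakk> \<Longrightarrow> downward_responsive L U (B k) (zs ! k) (q $ (zs ! k))"
    using ok unfolding ok_def by blast+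
  have "n \<le> length zs \<Longrightarrow> \<exists>p\<in>open_box L U. p $ z0 = \<pi> \<and>
      (\<forall>k. 1 \<le> k \<and> k < n \<longrightarrow> B k p < q $ (zs ! k))" for n
  proof (induction n)
    case 0
    obtain p where "p \<in> open_box L U"
      using open_box_nonempty[of L U] bounds by blast
    then show ?case
      using pi by (intro bexI[of _ "upd p z0 \<pi>"] upd_in_open_box) auto
  next
    case (Suc n)
    then obtain a where a: "a \<in> open_box L U" "a $ z0 = \<pi>"
      "\<And>k. 1 \<le> k \<Longrightarrow> k < n \<Longrightarrow> B k a < q $ (zs ! k)"
      by auto
    show ?case
    \<comment> \<open>Index 0 belongs to \<open>z0\<close>, whose price is already pinned at
      \<open>\<pi>\<close>, so this stage has nothing to choose.\<close>
    proof (cases "n = 0")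
      case True
      with a show ?thesis
        by auto
    next
      case False
      then have n: "1 \<le> n" "n < length zs"
        using Suc.prems by auto
      let ?x = "zs ! n"
      obtain l where l: "((\<lambda>p. ereal (B n p)) \<longlongrightarrow> l) (to_lower L U {?x} a)" "l < ereal (q $ ?x)"
        using B(3)[OF n] a(1) unfolding downward_responsive_def by blast
      from order_tendstoD(2)[OF l]
      obtain M where M: "M > L ?x"
        "\<And>p. \<lbrakk>p \<in> open_box L U; \<And>z. z \<noteq> ?x \<Longrightarrow> p $ z = a $ z; ereal (p $ ?x) < M\<rbrakk>
          \<Longrightarrow> ereal (B n p) < ereal (q $ ?x)"
        by (rule eventually_to_lower_singletonD) (use bounds in auto)
      obtain t where t: "L ?x < ereal t" "ereal t < min M (U ?x)"
        using ereal_dense2[of "L ?x" "min M (U ?x)"] M(1) bounds by auto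
      define p where "p = upd a ?x t"
      have box: "p \<in> open_box L U"
        unfolding p_def using a(1) t by (intro upd_in_open_box) auto
      have "B n p < q $ ?x"
        using M(2)[OF box] t by (simp add: p_def)
      moreover have "B k p < q $ (zs ! k)" if "1 \<le> k" "k < n" for k
      proof -
        have "zs ! i \<noteq> ?x" if "i \<le> k" for i
          using that \<open>k < n\<close> n dist by (simp add: nth_eq_iff_index_eq)
        then have "B k p = B k a"
          using that n a(1) box by (intro B(2)) (auto simp: p_def)
        with a(3) that show ?thesis
          by simp
      qed
      moreover have "z0 \<noteq> ?x"
        using zs0 n dist nth_eq_iff_index_eq[of zs 0 n] by auto
      then have "p $ z0 = \<pi>"
        using a(2) by (simp add: p_def)
      ultimately show ?thesis
        using box by (intro bexI[of _ p]) (auto simp: less_Suc_eq)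
    qed
  qed
  from this[of "length zs"] obtain p where p: "p \<in> open_box L U" "p $ z0 = \<pi>"
    "\<And>k. \<lbrakk>1 \<le> k; k < length zs\<rbrakk> \<Longrightarrow> B k p < q $ (zs ! k)"
    by auto
  show thesis
    using p B(1) by (intro that[of p]) (auto intro: order_trans[OF _ less_imp_le])
qed

text \<open>This keeps the supremum of \<open>A\<close> inside the box, also where
  \<open>U z\<close> is infinite. The contradiction comes from the constant total: pivotality pushes
  the sum over \<open>-S\<close> strictly below that of \<open>q\<close>, while a join of points of
  \<open>A\<close> keeps the sum over \<open>S\<close> from exceeding that of
  \<open>q\<close>.\<close>

lemma excess_prices_bounded:
  fixes L U :: "'z::finite \<Rightarrow> ereal"
  assumes bounds: "\<And>z. L z < U z"
    and Q: "Q \<in> open_box L U \<rightarrow> quantity_plane c" and q: "q \<in> quantity_plane c"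
    and weak: "weak_substitutes L U Q"
    and pivotal: "downward_pivotal_substitutes L U Q q"
    and A: "A = {p \<in> open_box L U. p $ z0 = \<pi> \<and> (\<forall>z. z \<noteq> z0 \<longrightarrow> Q p $ z \<le> q $ z)}"
    and p0: "p0 \<in> A"
  obtains b where "\<And>z. ereal (b z) < U z" "\<And>p z. p \<in> A \<Longrightarrow> p $ z \<le> b z"
proof -
  define S where "S = {z. \<forall>M<U z. \<exists>p\<in>A. M < ereal (p $ z)}"
  have bdd: "\<exists>b. ereal b < U z \<and> (\<forall>p\<in>A. p $ z \<le> b)" if "z \<notin> S" for z
  proof -
    from that obtain M where M: "M < U z" "\<And>p. p \<in> A \<Longrightarrow> ereal (p $ z) \<le> M"
      unfolding S_def by force
    \<comment> \<open>\<open>M\<close> is finite: it lies below \<open>U z\<close> and above the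
      real price \<open>p0 $ z\<close>.\<close>
    from M(1) M(2)[OF p0] obtain m where "M = ereal m"
      by (cases M) auto
    with M show ?thesis
      by auto
  qed
  then obtain b where b: "\<And>z. z \<notin> S \<Longrightarrow> ereal (b z) < U z" "\<And>z p. z \<notin> S \<Longrightarrow> p \<in> A \<Longrightarrow> p $ z \<le> b z"
    by metis
  \<comment> \<open>Every point of \<open>A\<close> has price \<open>\<pi>\<close> at
    \<open>z0\<close>, so none exceeds the threshold \<open>\<pi>\<close>. This makes
    \<open>-S\<close> nonempty, as pivotality requires.\<close>
  have "z0 \<notin> S"
    using p0 unfolding S_def A by (auto simp: open_box_def intro!: exI[of _ "ereal \<pi>"])
  have "S = {}"
  proof (rule ccontr)
    assume "S \<noteq> {}"
    \<comment> \<open>Off \<open>S\<close> the prices are frozen at bounds that dominate all of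
      \<open>A\<close>; on \<open>S\<close> the entries of \<open>p0\<close> merely place
      \<open>a\<close> in the box.\<close>
    define a where "a = (\<chi> z. if z \<in> S then p0 $ z else b z)"
    have p0_box: "p0 \<in> open_box L U"
      using p0 A by simp
    have L_b: "L z < ereal (b z)" if "z \<notin> S" for z
      using b(2)[OF that p0] p0_box unfolding open_box_def
      by (auto intro: less_le_trans[of _ "ereal (p0 $ z)"])
    have a: "a \<in> open_box L U"
      using p0_box L_b b(1) by (auto simp: a_def open_box_def)
    have "\<forall>\<^sub>F p in to_upper L U S a. (\<Sum>x\<in>-S. Q p $ x) < (\<Sum>x\<in>-S. q $ x)"
      using pivotal \<open>S \<noteq> {}\<close> \<open>z0 \<notin> S\<close> a unfolding downward_pivotal_substitutes_def
      by (metis Compl_UNIV_eq Compl_iff double_complement empty_iff psubsetI subset_UNIV)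
    then obtain M where M: "\<And>z. z \<in> S \<Longrightarrow> M z < U z"
      "\<And>p. \<lbrakk>p \<in> open_box L U; \<And>z. z \<notin> S \<Longrightarrow> p $ z = a $ z; \<And>z. z \<in> S \<Longrightarrow> M z < ereal (p $ z)\<rbrakk>
        \<Longrightarrow> (\<Sum>x\<in>-S. Q p $ x) < (\<Sum>x\<in>-S. q $ x)"
      by (rule eventually_to_upperD) (use bounds in auto)
    have "\<forall>z\<in>S. \<exists>p\<in>A. M z < ereal (p $ z)"
      using M(1) by (auto simp: S_def)
    then obtain w where w: "\<And>z. z \<in> S \<Longrightarrow> w z \<in> A" "\<And>z. z \<in> S \<Longrightarrow> M z < ereal (w z $ z)"
      by metis
    \<comment> \<open>On \<open>S\<close> this is the join of the finitely many witnesses, so each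
      coordinate is attained by some \<open>w y\<close> and stays below \<open>U z\<close>. As
      \<open>r\<close> dominates that \<open>w y\<close> and agrees with it at \<open>z\<close>,
      weak substitutes give \<open>Q r $ z \<le> Q (w y) $ z\<close>.\<close>
    define r where "r = (\<chi> z. if z \<in> S then Max ((\<lambda>y. w y $ z) ` S) else b z)"
    have attained: "\<exists>y\<in>S. r $ z = w y $ z" if "z \<in> S" for z
    proof -
      have "Max ((\<lambda>y. w y $ z) ` S) \<in> (\<lambda>y. w y $ z) ` S"
        using that by (intro Max_in) auto
      with that show ?thesis
        unfolding r_def image_iff by simp
    qed
    have r_ge: "w y $ z \<le> r $ z" if "y \<in> S" for y z
      using that w(1) b(2) by (auto simp: r_def)
    have "L z < ereal (r $ z) \<and> ereal (r $ z) < U z" for z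
    proof (cases "z \<in> S")
      case True
      then obtain y where "y \<in> S" "r $ z = w y $ z"
        using attained by blast
      with w(1)[of y] show ?thesis
        by (auto simp: A open_box_def)
    next
      case False
      with L_b b(1) show ?thesis
        by (simp add: r_def)
    qed
    then have r: "r \<in> open_box L U"
      by (simp add: open_box_def)
    have "Q r $ z \<le> q $ z" if z: "z \<in> S" for z
    proof -
      obtain y where y: "y \<in> S" "r $ z = w y $ z"
        using attained z by blast
      have "Q r $ z \<le> Q (w y) $ z"
        using w(1)[OF y(1)] r r_ge[OF y(1)] y(2)
        by (intro weak_substitutes_antimono[OF weak]) (auto simp: A)
      also have "\<dots> \<le> q $ z"
        using w(1)[OF y(1)] z \<open>z0 \<notin> S\<close> by (auto simp: A)
      finally show ?thesis .
    qed
    then have "(\<Sum>x\<in>S. Q r $ x) \<le> (\<Sum>x\<in>S. q $ x)"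
      by (rule sum_mono)
    moreover have "(\<Sum>x\<in>-S. Q r $ x) < (\<Sum>x\<in>-S. q $ x)"
    proof (rule M(2)[OF r])
      show "r $ z = a $ z" if "z \<notin> S" for z
        using that by (simp add: r_def a_def)
      show "M z < ereal (r $ z)" if "z \<in> S" for z
        using w(2)[OF that] r_ge[OF that, of z] by (meson ereal_less_eq(3) less_le_trans)
    qed
    moreover have "(\<Sum>x\<in>UNIV. f x) = (\<Sum>x\<in>S. f x) + (\<Sum>x\<in>-S. f x)" for f :: "'z \<Rightarrow> real"
      using sum.subset_diff[of S UNIV f] by (simp add: Compl_eq_Diff_UNIV add.commute)
    moreover have "(\<Sum>x\<in>UNIV. Q r $ x) = (\<Sum>x\<in>UNIV. q $ x)"
      using Q q r by (auto simp: quantity_plane_def Pi_iff)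
    ultimately show False
      by simp
  qed
  with b show thesis
    by (intro that[of b]) auto
qed

section \<open>The supremum of \<open>A\<close> as the solution\<close>

theorem theorem1:
  fixes L U :: "'z::finite \<Rightarrow> ereal"
    and z0 :: 'z
    and c \<pi> :: real
    and q :: "real ^ 'z"
    and Q :: "real ^ 'z \<Rightarrow> real ^ 'z"
  assumes bounds: "\<And>z. L z < U z"
    and q: "q \<in> quantity_plane c"
    and Q: "Q \<in> open_box L U \<rightarrow> quantity_plane c"
    and cont: "continuous_on (open_box L U) Q"
    and weak: "weak_substitutes L U Q"
    and pivotal: "pivotal_substitutes L U Q q"
    and resp: "\<And>x. responsive L U (\<lambda>p. Q p $ x) x (q $ x)"
    and order: "\<exists>zs. distinct zs \<and> set zs = UNIV \<and> zs ! 0 = z0 \<and>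
      (\<forall>k. 1 \<le> k \<and> k < length zs \<longrightarrow>
        (\<exists>Qbar :: real ^ 'z \<Rightarrow> real.
          (\<forall>p\<in>open_box L U. Q p $ (zs ! k) \<le> Qbar p) \<and>
          (\<forall>p\<in>open_box L U. \<forall>p'\<in>open_box L U.
             (\<forall>i\<le>k. p $ (zs ! i) = p' $ (zs ! i)) \<longrightarrow> Qbar p = Qbar p') \<and>
          downward_responsive L U Qbar (zs ! k) (q $ (zs ! k))))"
    and pi: "L z0 < ereal \<pi>" "ereal \<pi> < U z0"
  shows "\<exists>p\<in>open_box L U. Q p = q \<and> p $ z0 = \<pi>"
proof -
  obtain zs where zs: "distinct zs" "set zs = UNIV" "zs ! 0 = z0" and
    Qbar: "\<And>k. \<lbrakk>1 \<le> k; k < length zs\<rbrakk> \<Longrightarrow>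
        (\<exists>Qbar :: real ^ 'z \<Rightarrow> real.
          (\<forall>p\<in>open_box L U. Q p $ (zs ! k) \<le> Qbar p) \<and>
          (\<forall>p\<in>open_box L U. \<forall>p'\<in>open_box L U.
             (\<forall>i\<le>k. p $ (zs ! i) = p' $ (zs ! i)) \<longrightarrow> Qbar p = Qbar p') \<and>
          downward_responsive L U Qbar (zs ! k) (q $ (zs ! k)))"
    using order by blast
  have "zs \<noteq> []"
    using zs(2) by auto
  obtain p0 where p0: "p0 \<in> open_box L U" "p0 $ z0 = \<pi>"
    "\<And>k. \<lbrakk>1 \<le> k; k < length zs\<rbrakk> \<Longrightarrow> Q p0 $ (zs ! k) \<le> q $ (zs ! k)"
    using ex_low_demand[OF bounds zs(1) \<open>zs \<noteq> []\<close> zs(3) Qbar pi] by blast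
  define A where "A = {p \<in> open_box L U. p $ z0 = \<pi> \<and> (\<forall>z. z \<noteq> z0 \<longrightarrow> Q p $ z \<le> q $ z)}"
  have "Q p0 $ z \<le> q $ z" if "z \<noteq> z0" for z
  proof -
    obtain k where "k < length zs" "z = zs ! k"
      using zs(2) by (metis UNIV_I in_set_conv_nth)
    with that zs(3) p0(3)[of k] show ?thesis
      by (cases k) auto
  qed
  then have p0_A: "p0 \<in> A"
    using p0 by (auto simp: A_def)
  obtain b where b: "\<And>z. ereal (b z) < U z" "\<And>p z. p \<in> A \<Longrightarrow> p $ z \<le> b z"
    using excess_prices_bounded[OF bounds Q q weak _ A_def p0_A] pivotal
    unfolding pivotal_substitutes_def by blast

  define s where "s = (\<chi> z. Sup ((\<lambda>p. p $ z) ` A))"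
  have s_ge: "p $ z \<le> s $ z" if "p \<in> A" for p z
    using that b(2) unfolding s_def by (auto intro!: cSUP_upper bdd_aboveI2)
  have s_approx: "\<exists>p\<in>A. t < p $ z" if "t < s $ z" for t z
    using that p0_A b(2) unfolding s_def
    by (subst (asm) vec_lambda_beta, subst (asm) less_cSUP_iff) (auto intro!: bdd_aboveI2)
  have s_le: "s $ z \<le> b z" for z
    using p0_A b(2) unfolding s_def by (auto intro!: cSUP_least)
  have "L z < ereal (s $ z)" for z
    using p0(1) s_ge[OF p0_A, of z] unfolding open_box_def
    by (auto intro: less_le_trans[of _ "ereal (p0 $ z)"])
  moreover have "ereal (s $ z) < U z" for z
    using s_le[of z] b(1)[of z] by (meson ereal_less_eq(3) le_less_trans)
  ultimately have s: "s \<in> open_box L U"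
    by (simp add: open_box_def)
  have "(\<lambda>p. p $ z0) ` A = {\<pi>}"
    using p0_A by (auto simp: A_def)
  then have "s $ z0 = \<pi>"
    by (simp add: s_def)

  \<comment> \<open>The filter is \<open>nhds\<close> because the point of \<open>A\<close> used
    below may attain the supremum, so \<open>t = s $ z\<close> must be covered.\<close>
  have cont_Q: "((\<lambda>t. Q (upd s z t) $ z) \<longlongrightarrow> Q s $ z) (nhds (s $ z))" for z
  proof -
    have "isCont Q s"
      using cont s open_open_box continuous_on_eq_continuous_at by blast
    then have "isCont (\<lambda>t. Q (upd s z t)) (s $ z)"
      by (intro isCont_o2[OF isCont_upd]) simp
    then have "isCont (\<lambda>t. Q (upd s z t) $ z) (s $ z)"
      by (intro continuous_intros)
    then show ?thesis
      using tendsto_at_iff_tendsto_nhds[of "\<lambda>t. Q (upd s z t) $ z" "s $ z"] by (simp add: isCont_def)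
  qed

  have Qs_le: "Q s $ z \<le> q $ z" if "z \<noteq> z0" for z
  proof (rule ccontr)
    assume "\<not> ?thesis"
    then have "\<forall>\<^sub>F t in nhds (s $ z). q $ z < Q (upd s z t) $ z"
      by (intro order_tendstoD(1)[OF cont_Q]) simp
    then obtain d where d: "d > 0" "\<And>t. dist t (s $ z) < d \<Longrightarrow> q $ z < Q (upd s z t) $ z"
      unfolding eventually_nhds_metric by blast
    obtain p where p: "p \<in> A" "s $ z - d < p $ z"
      using s_approx[of "s $ z - d" z] d(1) by auto
    \<comment> \<open>Resetting coordinate \<open>z\<close> of \<open>s\<close> to
      \<open>p $ z\<close> gives a vector that dominates \<open>p\<close> and agrees with it at
      \<open>z\<close>; continuity bounds \<open>Q\<close> there from below, weak substitutes from
      above.\<close>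
    then have "q $ z < Q (upd s z (p $ z)) $ z"
      using s_ge[OF p(1), of z] by (intro d(2)) (auto simp: dist_real_def)
    also have "\<dots> \<le> Q p $ z"
      using p s s_ge by (intro weak_substitutes_antimono[OF weak] upd_in_open_box)
        (auto simp: A_def open_box_def)
    also have "\<dots> \<le> q $ z"
      using p that by (simp add: A_def)
    finally show False
      by simp
  qed
  have Qs_eq: "Q s $ z = q $ z" if z: "z \<noteq> z0" for z
  proof (rule ccontr)
    assume "Q s $ z \<noteq> q $ z"
    with Qs_le[OF z] have "Q s $ z < q $ z"
      by simp
    then have "\<forall>\<^sub>F t in nhds (s $ z). Q (upd s z t) $ z < q $ z"
      by (intro order_tendstoD(2)[OF cont_Q]) simp
    moreover have "\<forall>\<^sub>F t in nhds (s $ z). upd s z t \<in> open_box L U"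
      using isCont_upd[of "s $ z" s z] tendsto_at_iff_tendsto_nhds[of "upd s z" "s $ z"]
      by (intro topological_tendstoD[OF _ open_open_box s]) (simp add: isCont_def)
    ultimately obtain d where d: "d > 0"
      "\<And>t. dist t (s $ z) < d \<Longrightarrow> Q (upd s z t) $ z < q $ z \<and> upd s z t \<in> open_box L U"
      using eventually_conj unfolding eventually_nhds_metric by (smt (verit, best))
    \<comment> \<open>A small increase of price \<open>z\<close> keeps component \<open>z\<close>
      below \<open>q $ z\<close> and can only lower the other components, so \<open>r\<close>
      belongs to \<open>A\<close> yet exceeds \<open>s\<close> at \<open>z\<close>.\<close>
    define r where "r = upd s z (s $ z + d / 2)"
    have r: "Q r $ z < q $ z" "r \<in> open_box L U"
      using d unfolding r_def by (auto simp: dist_real_def)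
    have "Q r $ x \<le> q $ x" if "x \<noteq> z0" for x
    proof (cases "x = z")
      case False
      then have "Q r $ x \<le> Q s $ x"
        using s r(2) d(1) by (intro weak_substitutes_antimono[OF weak]) (auto simp: r_def)
      with Qs_le[OF that] show ?thesis
        by simp
    qed (use r in simp)
    then have "r \<in> A"
      using r(2) z \<open>s $ z0 = \<pi>\<close> by (simp add: A_def r_def)
    from s_ge[OF this, of z] d(1) show False
      by (simp add: r_def)
  qed
  have "Q s $ z0 = q $ z0"
  proof -
    have "(\<Sum>z\<in>UNIV. Q s $ z) = (\<Sum>z\<in>UNIV. q $ z)"
      using Q q s by (auto simp: quantity_plane_def Pi_iff)
    then show ?thesis
      using Qs_eq by (simp add: sum.remove[of UNIV z0])
  qed
  with Qs_eq have "Q s = q"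
    unfolding vec_eq_iff by metis
  with s \<open>s $ z0 = \<pi>\<close> show ?thesis
    by blast
qed

end
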